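(* Let $n$ be a positive perfect square, let $G$ be an $n\times n$ Sudoku grid and let $U$ be an arbitrary minimal unavoidable set of $G$. Then the inequality $$\sum_{(i,j)\in U} y_{ij}\ge 1$$ is a globally valid inequality for the leader of the bilevel program $\mathrm{B}(G)$; that is, every feasible solution $(x,y,z)$ of $\mathrm{B}(G)$ satisfies it.
   Context: Let $[n]=\{1,\dots,n\}$ and $s=\sqrt n$. A Sudoku grid is an $n\times n$ matrix with entries in $[n]$ such that each number of $[n]$ appears exactly once in each row, in each column and in each of the $n$ subgrids $\{sp-s+1,\dots,sp\}\times\{sq-s+1,\dots,sq\}$, $p,q\in[s]$. A cell is a pair $(i,j)\in[n]\times[n]$. A set of cells $U$ is an unavoidable set for a Sudoku grid $G$ if there exists a Sudoku grid $G'\neq G$ that differs from $G$ only on cells in $U$. It is minimal (minimally unavoidable) if it contains no proper subset that is again an unavoidable set for $G$. The bilevel program $\mathrm{B}(G)$. The leader problem is $$\min_{x,y,z}\ \sum_{i=1}^n\sum_{j=1}^n y_{ij}\quad\text{s.t.}\quad z=1,\quad y_{ij}\in\{0,1\}\ \ \forall i,j\in[n],\quad (x,z)\in S(y),$$ where $S(y)$ is the set of optimal solutions $(x,z)$ of the $y$-parameterized follower problem: minimize $z$ over $x=(x_{ijk})_{i,j,k\in[n]}$ and $z$ subject to $$\sum_{k=1}^n x_{ijk}=1\ \ \forall i,j\in[n],\qquad \sum_{j=1}^n x_{ijk}=1\ \ \forall i,k\in[n],\qquad \sum_{i=1}^n x_{ijk}=1\ \ \forall j,k\in[n],$$ $$\sum_{i=sp-s+1}^{sp}\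 \sum_{j=sq-s+1}^{sq}x_{ijk}=1\ \ \forall p,q\in[s],\ k\in[n],$$ $$x_{ijG_{ij}}\ge y_{ij}\ \ \forall i,j\in[n],\qquad \sum_{i=1}^n\sum_{j=1}^n x_{ijG_{ij}}-z\le n^2-1,\qquad x_{ijk},z\in\{0,1\}\ \ \forall i,j,k\in[n].$$ A feasible solution of $\mathrm{B}(G)$ is a triple $(x,y,z)$ satisfying all constraints of the leader problem, including $(x,z)\in S(y)$. *)

theory Defs
  imports Complex_Main "HOL-Library.FuncSet" "HOL-Library.Discrete_Functions"
    "HOL-Computational_Algebra.Nth_Powers"
begin

definition cells :: "nat \<Rightarrow> (nat \<times> nat) set" where
  "cells n = {1..n} \<times> {1..n}"

text \<open>
  The natural-number root \<open>floor_sqrt n\<close> is the exact square root whenever \<open>n\<close> is a perfect square,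
  the only case of interest. Indices start at 1, so the truncated subtraction in \<open>s * p - s\<close> is exact.
\<close>

definition band :: "nat \<Rightarrow> nat \<Rightarrow> nat set" where
  "band n p = (let s = floor_sqrt n in {s * p - s + 1..s * p})"

definition subgrid :: "nat \<Rightarrow> nat \<Rightarrow> nat \<Rightarrow> (nat \<times> nat) set" where
  "subgrid n p q = band n p \<times> band n q"

text \<open>
  A matrix is an extensional function on the cells, so that equality of functions is equality of
  matrices; this matters for \<open>G' \<noteq> G\<close> below.
\<close>

definition sudoku_grid :: "nat \<Rightarrow> (nat \<times> nat \<Rightarrow> nat) \<Rightarrow> bool" where
  "sudoku_grid n G \<longleftrightarrow>
     G \<in> cells n \<rightarrow>\<^sub>E {1..n} \<and>
     (\<forall>k\<in>{1..n}.
        (\<forall>i\<in>{1..n}. \<exists>!j. j \<in> {1..n} \<and> G (i, j) = k) \<and>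
        (\<forall>j\<in>{1..n}. \<exists>!i. i \<in> {1..n} \<and> G (i, j) = k) \<and>
        (\<forall>p\<in>{1..floor_sqrt n}. \<forall>q\<in>{1..floor_sqrt n}. \<exists>!c. c \<in> subgrid n p q \<and> G c = k))"

definition unavoidable :: "nat \<Rightarrow> (nat \<times> nat \<Rightarrow> nat) \<Rightarrow> (nat \<times> nat) set \<Rightarrow> bool" where
  "unavoidable n G U \<longleftrightarrow>
     U \<subseteq> cells n \<and>
     (\<exists>G'. sudoku_grid n G' \<and> G' \<noteq> G \<and> (\<forall>c\<in>cells n - U. G' c = G c))"

definition minimal_unavoidable :: "nat \<Rightarrow> (nat \<times> nat \<Rightarrow> nat) \<Rightarrow> (nat \<times> nat) set \<Rightarrow> bool" where
  "minimal_unavoidable n G U \<longleftrightarrow> unavoidable n G U \<and> (\<forall>V. V \<subset> U \<longrightarrow> \<not> unavoidable n G V)"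

text \<open>
  Decision variables are real-valued families. Only their values at indices in \<open>{1..n}\<close> are
  constrained or used; the values at other indices are irrelevant.
\<close>

definition follower_feasible ::
  "nat \<Rightarrow> (nat \<times> nat \<Rightarrow> nat) \<Rightarrow> (nat \<Rightarrow> nat \<Rightarrow> real)
    \<Rightarrow> (nat \<Rightarrow> nat \<Rightarrow> nat \<Rightarrow> real) \<Rightarrow> real \<Rightarrow> bool" where
  "follower_feasible n G y x z \<longleftrightarrow>
     (\<forall>i\<in>{1..n}. \<forall>j\<in>{1..n}. (\<Sum>k=1..n. x i j k) = 1) \<and>
     (\<forall>i\<in>{1..n}. \<forall>k\<in>{1..n}. (\<Sum>j=1..n. x i j k) = 1) \<and>
     (\<forall>j\<in>{1..n}. \<forall>k\<in>{1..n}. (\<Sum>i=1..n. x i j k) = 1) \<and>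
     (\<forall>p\<in>{1..floor_sqrt n}. \<forall>q\<in>{1..floor_sqrt n}. \<forall>k\<in>{1..n}.
        (\<Sum>i\<in>band n p. \<Sum>j\<in>band n q. x i j k) = 1) \<and>
     (\<forall>i\<in>{1..n}. \<forall>j\<in>{1..n}. x i j (G (i, j)) \<ge> y i j) \<and>
     (\<Sum>i=1..n. \<Sum>j=1..n. x i j (G (i, j))) - z \<le> (real n)\<^sup>2 - 1 \<and>
     (\<forall>i\<in>{1..n}. \<forall>j\<in>{1..n}. \<forall>k\<in>{1..n}. x i j k \<in> {0, 1}) \<and>
     z \<in> {0, 1}"

definition follower_optimal ::
  "nat \<Rightarrow> (nat \<times> nat \<Rightarrow> nat) \<Rightarrow> (nat \<Rightarrow> nat \<Rightarrow> real)
    \<Rightarrow> ((nat \<Rightarrow> nat \<Rightarrow> nat \<Rightarrow> real) \<times> real) set" where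
  "follower_optimal n G y =
     {(x, z). follower_feasible n G y x z \<and>
        (\<forall>x' z'. follower_feasible n G y x' z' \<longrightarrow> z \<le> z')}"

definition bilevel_feasible ::
  "nat \<Rightarrow> (nat \<times> nat \<Rightarrow> nat) \<Rightarrow> (nat \<Rightarrow> nat \<Rightarrow> nat \<Rightarrow> real)
    \<Rightarrow> (nat \<Rightarrow> nat \<Rightarrow> real) \<Rightarrow> real \<Rightarrow> bool" where
  "bilevel_feasible n G x y z \<longleftrightarrow>
     z = 1 \<and>
     (\<forall>i\<in>{1..n}. \<forall>j\<in>{1..n}. y i j \<in> {0, 1}) \<and>
     (x, z) \<in> follower_optimal n G y"

end

theory Submission
  imports Defs
begin

text \<open>
  If \<open>y\<close> vanished on \<open>U\<close>, a second grid \<open>G'\<close> that differs from \<open>G\<close> only on \<open>U\<close> would, through its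
  indicator variables, be a follower solution with \<open>z = 0\<close>, so \<open>z = 1\<close> could not be optimal.
\<close>

text \<open>Bridge from the "exactly once" clauses of \<open>sudoku_grid\<close> to the equality
  constraints of the follower.\<close>

lemma sum_of_bool_ex1:
  assumes "finite A" and "\<exists>!a. a \<in> A \<and> P a"
  shows "(\<Sum>a\<in>A. of_bool (P a)) = (1 :: real)"
proof -
  from assms(2) obtain a where "A \<inter> {a. P a} = {a}"
    by blast
  then show ?thesis
    using assms(1) by simp
qed

text \<open>The bound on \<open>y\<close> is the coupling constraint read at the indicator variables
  of \<open>G'\<close>. The cell \<open>c\<close> where the grids differ keeps the number of
  agreements below the number of cells, which is what allows \<open>z = 0\<close>.\<close>

lemma sudoku_grid_follower_feasible:
  assumes G': "sudoku_grid n G'" and ne: "c \<in> cells n" "G' c \<noteq> G c"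
    and y: "\<forall>i\<in>{1..n}. \<forall>j\<in>{1..n}. y i j \<le> of_bool (G' (i, j) = G (i, j))"
  shows "follower_feasible n G y (\<lambda>i j k. of_bool (G' (i, j) = k)) 0"
proof -
  note once = G'[unfolded sudoku_grid_def, THEN conjunct2, THEN bspec]
  have range: "G' (i, j) \<in> {1..n}" if "i \<in> {1..n}" "j \<in> {1..n}" for i j
    using G' that unfolding sudoku_grid_def cells_def by blast
  have cell: "(\<Sum>k=1..n. of_bool (G' (i, j) = k)) = (1 :: real)"
    if "i \<in> {1..n}" "j \<in> {1..n}" for i j
    using range[OF that] by (intro sum_of_bool_ex1) auto
  have row: "(\<Sum>j=1..n. of_bool (G' (i, j) = k)) = (1 :: real)"
    if "i \<in> {1..n}" "k \<in> {1..n}" for i k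
    using once[OF that(2), THEN conjunct1] that(1)
    by (intro sum_of_bool_ex1 finite_atLeastAtMost) (rule bspec)
  have column: "(\<Sum>i=1..n. of_bool (G' (i, j) = k)) = (1 :: real)"
    if "j \<in> {1..n}" "k \<in> {1..n}" for j k
    using once[OF that(2), THEN conjunct2, THEN conjunct1] that(1)
    by (intro sum_of_bool_ex1 finite_atLeastAtMost) (rule bspec)
  have subgrid: "(\<Sum>i\<in>band n p. \<Sum>j\<in>band n q. of_bool (G' (i, j) = k)) = (1 :: real)"
    if "p \<in> {1..floor_sqrt n}" "q \<in> {1..floor_sqrt n}" "k \<in> {1..n}" for p q k
  proof -
    have "finite (subgrid n p q)"
      by (simp add: subgrid_def band_def Let_def)
    moreover have "\<exists>!c. c \<in> subgrid n p q \<and> G' c = k"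
      by (rule bspec[OF bspec[OF once[OF that(3), THEN conjunct2, THEN conjunct2] that(1)] that(2)])
    ultimately have "(\<Sum>c\<in>subgrid n p q. of_bool (G' c = k)) = (1 :: real)"
      by (rule sum_of_bool_ex1)
    then show ?thesis
      \<comment> \<open>Without \<open>sum_of_bool_eq\<close>, simp keeps the indicator sums as sums
        instead of turning them into cardinalities, so the double sum can merge into one over
        pairs.\<close>
      by (simp add: subgrid_def sum.cartesian_product split_def del: sum_of_bool_eq)
  qed
  have total: "(\<Sum>i=1..n. \<Sum>j=1..n. of_bool (G' (i, j) = G (i, j))) \<le> (real n)\<^sup>2 - 1"
  proof -
    have fin: "finite (cells n)"
      by (simp add: cells_def)
    have "(\<Sum>i=1..n. \<Sum>j=1..n. of_bool (G' (i, j) = G (i, j)))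
        = (\<Sum>d\<in>cells n. of_bool (G' d = G d) :: real)"
      by (simp add: cells_def sum.cartesian_product split_def del: sum_of_bool_eq)
    \<comment> \<open>The term at \<open>c\<close> is 0; each remaining term is at most 1.\<close>
    also have "\<dots> = (\<Sum>d\<in>cells n - {c}. of_bool (G' d = G d))"
      using fin ne by (simp add: sum.remove del: sum_of_bool_eq)
    also have "\<dots> \<le> real (card (cells n - {c})) * 1"
      by (rule sum_bounded_above) simp
    also have "\<dots> = real (card (cells n)) - 1"
      using card_Suc_Diff1[OF fin ne(1)] by linarith
    finally show ?thesis
      by (simp add: cells_def power2_eq_square)
  qed
  show ?thesis
    unfolding follower_feasible_def
  proof (intro conjI ballI)
    fix i j assume "i \<in> {1..n}" "j \<in> {1..n}"
    then show "y i j \<le> of_bool (G' (i, j) = G (i, j))"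
      using y by blast
  qed (use cell row column subgrid total in simp_all)
qed

theorem corollary2:
  fixes n :: nat
    and G :: "nat \<times> nat \<Rightarrow> nat"
    and U :: "(nat \<times> nat) set"
  assumes "n > 0"
    and "is_square n"
    and "sudoku_grid n G"
    and "minimal_unavoidable n G U"
  shows "\<forall>x y z. bilevel_feasible n G x y z \<longrightarrow> (\<Sum>(i, j)\<in>U. y i j) \<ge> 1"
proof (intro allI impI)
  fix x y z
  assume feasible: "bilevel_feasible n G x y z"
  have binary: "y i j \<in> {0, 1}" if "(i, j) \<in> cells n" for i j
    using feasible that by (simp add: bilevel_feasible_def cells_def)
  obtain G' where U: "U \<subseteq> cells n" and G': "sudoku_grid n G'" "G' \<noteq> G"
    and agree: "\<forall>c\<in>cells n - U. G' c = G c"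
    using assms(4) unfolding minimal_unavoidable_def unavoidable_def by blast
  have fin: "finite U"
    using U by (rule finite_subset) (simp add: cells_def)
  \<comment> \<open>Both grids are extensional, so they can differ as functions only by differing at
    some cell.\<close>
  have "G' \<in> cells n \<rightarrow>\<^sub>E {1..n}" "G \<in> cells n \<rightarrow>\<^sub>E {1..n}"
    using G'(1) assms(3) by (simp_all only: sudoku_grid_def)
  then obtain c where c: "c \<in> cells n" "G' c \<noteq> G c"
    using G'(2) by (meson PiE_ext)
  \<comment> \<open>Such a point would undercut the optimal value \<open>z = 1\<close>.\<close>
  have "\<not> follower_feasible n G y x' 0" for x'
    using feasible by (fastforce simp: bilevel_feasible_def follower_optimal_def)
  then obtain i j where ij: "i \<in> {1..n}" "j \<in> {1..n}"
    and "\<not> y i j \<le> of_bool (G' (i, j) = G (i, j))"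
    using sudoku_grid_follower_feasible[of n G' c G y, OF G'(1) c] by blast
  moreover from ij have "(i, j) \<in> cells n"
    by (simp add: cells_def)
  \<comment> \<open>A binary value exceeds an indicator only as 1 against 0. Hence the grids differ
    at \<open>(i, j)\<close>, and by \<open>agree\<close> they can do so only inside
    \<open>U\<close>.\<close>
  ultimately have "(i, j) \<in> U" "y i j = 1"
    using binary[of i j] agree by (auto simp: of_bool_def split: if_splits)
  moreover have "0 \<le> y i j" if "(i, j) \<in> U" for i j
    using binary[OF subsetD[OF U that]] by auto
  \<comment> \<open>All terms are nonnegative, so the single term equal to 1 bounds the sum from
    below.\<close>
  ultimately show "(\<Sum>(i, j)\<in>U. y i j) \<ge> 1"
    using member_le_sum[of "(i, j)" U "\<lambda>(i, j). y i j"] fin by auto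
qed

end
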